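(* Let $\mathscr{H}$ be a complex Hilbert space and let $\mathscr{X}$ be a Hilbert $C^*$-module over the $C^*$-algebra $\mathbb{K}(\mathscr{H})$ of compact operators on $\mathscr{H}$. For $x, y\in\mathscr{X}$ the following statements are equivalent: (i) $x\parallel y$. (ii) There exists a positive trace class operator $P\in\mathcal{C}_1(\mathscr{H})$ of trace one such that $|\mathrm{tr}(P\langle x, y\rangle)| = \|x\|\,\|y\|$.
   Context: A Hilbert $C^*$-module over a $C^*$-algebra $\mathscr{A}$ is a complex linear space $\mathscr{X}$ that is a right $\mathscr{A}$-module (with compatible scalar multiplication) with an $\mathscr{A}$-valued inner product $\langle\cdot,\cdot\rangle$ that is linear in the second variable, satisfies $\langle x, ya\rangle=\langle x,y\rangle a$, $\langle x,y\rangle^*=\langle y,x\rangle$, $\langle x,x\rangle\ge 0$ with $\langle x,x\rangle=0$ iff $x=0$, and such that $\mathscr{X}$ is complete for the norm $\|x\|=\|\langle x,x\rangle\|^{1/2}$. In a normed space, $x\parallel y$ (norm-parallel) means that $\|x+\lambda y\|=\|x\|+\|y\|$ for some $\lambda\in\mathbb{T}=\{\alpha\in\mathbb{C}:|\alpha|=1\}$. $\mathcal{C}_1(\mathscr{H})$ is the set of compact operators $T$ on $\mathscr{H}$ with $\mathrm{tr}(|T|)<\infty$, where $|T|=(T^*T)^{1/2}$ and $\mathrm{tr}$ is the usual trace. *)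

theory Defs
  imports "HOL-Analysis.Analysis"
begin

section \<open>Complex vector spaces and complex Hilbert spaces\<close>

class scaleC =
  fixes scaleC :: "complex \<Rightarrow> 'a \<Rightarrow> 'a"  (infixr \<open>*\<^sub>C\<close> 75)

class complex_vector = real_vector + scaleC +
  assumes scaleC_add_right: "a *\<^sub>C (x + y) = a *\<^sub>C x + a *\<^sub>C y"
    and scaleC_add_left: "(a + b) *\<^sub>C x = a *\<^sub>C x + b *\<^sub>C x"
    and scaleC_scaleC: "a *\<^sub>C (b *\<^sub>C x) = (a * b) *\<^sub>C x"
    and scaleC_one: "1 *\<^sub>C x = x"
    and scaleR_scaleC: "r *\<^sub>R x = complex_of_real r *\<^sub>C x"

class complex_normed_vector = complex_vector + real_normed_vector +
  assumes norm_scaleC: "norm (a *\<^sub>C x) = cmod a * norm x"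

class complex_banach = complex_normed_vector + banach

text \<open>The inner product is linear in the second variable. Definiteness follows from the
  link with the norm.\<close>

class complex_hilbert_space = complex_banach +
  fixes cinner :: "'a \<Rightarrow> 'a \<Rightarrow> complex"
  assumes cinner_commute: "cinner x y = cnj (cinner y x)"
    and cinner_add_right: "cinner x (y + z) = cinner x y + cinner x z"
    and cinner_scaleC_right: "cinner x (a *\<^sub>C y) = a * cinner x y"
    and cinner_self_nonneg: "cinner x x \<in> \<real>\<^sub>\<ge>\<^sub>0"
    and norm_eq_sqrt_cinner: "norm x = sqrt (Re (cinner x x))"

instantiation complex :: complex_hilbert_space
begin

definition scaleC_complex :: "complex \<Rightarrow> complex \<Rightarrow> complex"
  where "scaleC_complex a x = a * x"

definition cinner_complex :: "complex \<Rightarrow> complex \<Rightarrow> complex"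
  where "cinner_complex x y = cnj x * y"

instance
proof
  fix x :: complex
  show "cinner x x \<in> \<real>\<^sub>\<ge>\<^sub>0"
    by (simp add: cinner_complex_def complex_nonneg_Reals_iff)
  show "norm x = sqrt (Re (cinner x x))"
    by (simp add: cinner_complex_def cmod_def power2_eq_square)
qed (auto simp: scaleC_complex_def cinner_complex_def algebra_simps norm_mult scaleR_conv_of_real)

end

section \<open>Bounded operators\<close>

text \<open>The type \<open>'h \<Rightarrow>\<^sub>L 'h\<close> consists of the bounded \<^emph>\<open>real\<close>-linear maps, with the operator
  norm; complex linearity is imposed by a predicate.\<close>

instantiation blinfun :: (real_normed_vector, complex_normed_vector) complex_vector
begin

lift_definition scaleC_blinfun :: "complex \<Rightarrow> 'a \<Rightarrow>\<^sub>L 'b \<Rightarrow> 'a \<Rightarrow>\<^sub>L 'b"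
  is "\<lambda>c f x. c *\<^sub>C f x"
proof -
  fix c :: complex and f :: "'a \<Rightarrow> 'b"
  assume "bounded_linear f"
  then interpret f: bounded_linear f .
  obtain K where K: "\<And>x. norm (f x) \<le> norm x * K"
    using f.bounded by blast
  show "bounded_linear (\<lambda>x. c *\<^sub>C f x)"
  proof (rule bounded_linear_intro[where K = "cmod c * K"])
    show "c *\<^sub>C f (r *\<^sub>R x) = r *\<^sub>R (c *\<^sub>C f x)" for r x
      by (simp add: f.scaleR scaleR_scaleC scaleC_scaleC mult.commute)
    show "norm (c *\<^sub>C f x) \<le> norm x * (cmod c * K)" for x
      using mult_left_mono[OF K[of x], of "cmod c"] by (simp add: norm_scaleC mult_ac)
  qed (simp add: f.add scaleC_add_right)
qed

instance
proof
  fix a b :: complex and r :: real and x y :: "'a \<Rightarrow>\<^sub>L 'b"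
  show "a *\<^sub>C (x + y) = a *\<^sub>C x + a *\<^sub>C y"
    by transfer (simp add: scaleC_add_right)
  show "(a + b) *\<^sub>C x = a *\<^sub>C x + b *\<^sub>C x"
    by transfer (simp add: scaleC_add_left)
  show "a *\<^sub>C (b *\<^sub>C x) = (a * b) *\<^sub>C x"
    by transfer (simp add: scaleC_scaleC)
  show "1 *\<^sub>C x = x"
    by transfer (simp add: scaleC_one)
  show "r *\<^sub>R x = complex_of_real r *\<^sub>C x"
    by transfer (simp add: scaleR_scaleC)
qed

end

definition complex_linear_op :: "('h::complex_normed_vector \<Rightarrow>\<^sub>L 'h) \<Rightarrow> bool"
  where "complex_linear_op T \<longleftrightarrow> (\<forall>c h. T (c *\<^sub>C h) = c *\<^sub>C T h)"

definition compact_ops :: "('h::complex_normed_vector \<Rightarrow>\<^sub>L 'h) set"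
  where "compact_ops = {T. complex_linear_op T \<and> compact (closure (blinfun_apply T ` cball 0 1))}"

definition adj :: "('h::complex_hilbert_space \<Rightarrow>\<^sub>L 'h) \<Rightarrow> 'h \<Rightarrow>\<^sub>L 'h"
  where "adj T = (THE S :: 'h \<Rightarrow>\<^sub>L 'h. \<forall>g h. cinner (S g) h = cinner g (T h))"

definition positive_op :: "('h::complex_hilbert_space \<Rightarrow>\<^sub>L 'h) \<Rightarrow> bool"
  where "positive_op T \<longleftrightarrow> complex_linear_op T \<and> (\<forall>h. cinner h (T h) \<in> \<real>\<^sub>\<ge>\<^sub>0)"

definition sqrt_op :: "('h::complex_hilbert_space \<Rightarrow>\<^sub>L 'h) \<Rightarrow> 'h \<Rightarrow>\<^sub>L 'h"
  where "sqrt_op T = (THE S. positive_op S \<and> S o\<^sub>L S = T)"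

definition abs_op :: "('h::complex_hilbert_space \<Rightarrow>\<^sub>L 'h) \<Rightarrow> 'h \<Rightarrow>\<^sub>L 'h"
  where "abs_op T = sqrt_op (adj T o\<^sub>L T)"

section \<open>Trace and trace class\<close>

definition orthonormal_basis :: "'h::complex_hilbert_space set \<Rightarrow> bool"
  where "orthonormal_basis B \<longleftrightarrow>
    (\<forall>e\<in>B. \<forall>f\<in>B. cinner e f = (if e = f then 1 else 0)) \<and>
    (\<forall>h. (\<forall>e\<in>B. cinner e h = 0) \<longrightarrow> h = 0)"

text \<open>The trace, and finiteness of \<open>tr |T|\<close>, do not depend on the orthonormal basis, so an
  arbitrary one is fixed. Sums are unordered, which covers nonseparable spaces.\<close>

definition some_basis :: "'h::complex_hilbert_space set"
  where "some_basis = (SOME B. orthonormal_basis B)"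

definition tr :: "('h::complex_hilbert_space \<Rightarrow>\<^sub>L 'h) \<Rightarrow> complex"
  where "tr T = (\<Sum>\<^sub>\<infinity>e\<in>some_basis. cinner e (T e))"

definition trace_class :: "('h::complex_hilbert_space \<Rightarrow>\<^sub>L 'h) set"
  where "trace_class =
    {T \<in> compact_ops. (\<lambda>e. cinner e (abs_op T e)) summable_on some_basis}"

section \<open>Hilbert modules over the compact operators\<close>

text \<open>The action is only constrained on \<open>compact_ops\<close>; its values at other operators are
  irrelevant. Completeness for the module norm is the class \<open>complex_banach\<close> together with
  \<open>norm_eq\<close>.\<close>

locale hilbert_compact_module =
  fixes act :: "'x::complex_banach \<Rightarrow> ('h::complex_hilbert_space \<Rightarrow>\<^sub>L 'h) \<Rightarrow> 'x"
    and ip :: "'x \<Rightarrow> 'x \<Rightarrow> ('h \<Rightarrow>\<^sub>L 'h)"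
  assumes act_add_left: "a \<in> compact_ops \<Longrightarrow> act (x + y) a = act x a + act y a"
    and act_add_right: "a \<in> compact_ops \<Longrightarrow> b \<in> compact_ops \<Longrightarrow> act x (a + b) = act x a + act x b"
    and act_mult: "a \<in> compact_ops \<Longrightarrow> b \<in> compact_ops \<Longrightarrow> act x (a o\<^sub>L b) = act (act x a) b"
    and act_scaleC_left: "a \<in> compact_ops \<Longrightarrow> act (c *\<^sub>C x) a = c *\<^sub>C act x a"
    and act_scaleC_right: "a \<in> compact_ops \<Longrightarrow> act x (c *\<^sub>C a) = c *\<^sub>C act x a"
    and ip_compact: "ip x y \<in> compact_ops"
    and ip_add_right: "ip x (y + z) = ip x y + ip x z"
    and ip_scaleC_right: "ip x (c *\<^sub>C y) = c *\<^sub>C ip x y"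
    and ip_act_right: "a \<in> compact_ops \<Longrightarrow> ip x (act y a) = ip x y o\<^sub>L a"
    and ip_adj: "adj (ip x y) = ip y x"
    and ip_self_positive: "positive_op (ip x x)"
    and ip_self_eq_0_iff: "ip x x = 0 \<longleftrightarrow> x = 0"
    and norm_eq: "norm x = sqrt (norm (ip x x))"

definition norm_parallel :: "'x::complex_normed_vector \<Rightarrow> 'x \<Rightarrow> bool"  (infix \<open>\<parallel>\<close> 50)
  where "x \<parallel> y \<longleftrightarrow> (\<exists>l. cmod l = 1 \<and> norm (x + l *\<^sub>C y) = norm x + norm y)"

end

theory Submission
  imports Defs
begin

text \<open>Both conditions say that some positive sesquilinear form \<open>s\<close> on the module with
\<open>s x x \<le> (norm x)\<^sup>2\<close> satisfies \<open>\<bar>s x y\<bar> = norm x * norm y\<close>. For such a form, the identity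
\<open>s (x + c y) (x + c y) = s x x + 2 Re (c s x y) + \<bar>c\<bar>\<^sup>2 s y y\<close> links the two sides. If
\<open>\<bar>s x y\<bar> = norm x * norm y\<close>, the Cauchy-Schwarz inequality forces \<open>s x x = (norm x)\<^sup>2\<close> and
\<open>s y y = (norm y)\<^sup>2\<close> (for nonzero \<open>x\<close> and \<open>y\<close>); with the phase \<open>c\<close> that turns \<open>c s x y\<close> into
its modulus, the right-hand side is \<open>(norm x + norm y)\<^sup>2\<close>, so that \<open>x \<parallel> y\<close>
(\<open>norm_parallel_if_norming\<close>). Conversely, if \<open>norm (x + c y) = norm x + norm y\<close> and \<open>s\<close> attains
the bound \<open>s z z = (norm z)\<^sup>2\<close> at \<open>z = x + c y\<close>, the identity leaves no room for
\<open>\<bar>s x y\<bar> < norm x * norm y\<close> (\<open>norming_if_norm_add\<close>).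

From parallelism to a trace: with \<open>z\<close> as above, \<open>ip z z\<close> is compact and positive, hence has a
unit eigenvector \<open>h\<close> for its norm (\<open>compact_positive_op_norming_vector\<close>). The form
\<open>s x y = cinner h (ip x y h)\<close> attains its bound at \<open>z\<close>, and it is the trace of \<open>ip x y\<close> against
the projection onto the line of \<open>h\<close> (\<open>tr_rank_one_compose\<close>).

From a trace to parallelism: write \<open>P\<close> as \<open>A\<^sup>2\<close> with \<open>A\<close> self-adjoint. Then \<open>A\<close> is a
Hilbert-Schmidt operator of Hilbert-Schmidt norm one, and cyclicity of the trace gives
\<open>tr (P T) = (\<Sum>e. cinner (A e) (T (A e)))\<close> (\<open>trace_compose_positive\<close>). So \<open>tr (P (ip x y))\<close> is a
sum of forms given by the vectors \<open>A e\<close>, whose squared norms add up to one, and is therefore a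
form of the required kind (\<open>contractive_form_vector_family\<close>).

The underlying Hilbert space theory is developed from orthonormal bases: a maximal orthonormal
set gives the expansion \<open>h = (\<Sum>e. cinner e h e)\<close>, from which follow Parseval's identity and, by
the Riesz representation, the characteristic property of adjoints. The square root of a positive
operator comes from a fixed-point iteration.\<close>

section \<open>Positive sesquilinear forms\<close>

text \<open>Used for the inner product itself, for \<open>cinner g (T h)\<close> with a positive operator \<open>T\<close>, and for the
forms on the module that states of the compact operators induce. Hermitian symmetry is not an
axiom because it follows from positivity.\<close>

locale positive_form =
  fixes s :: "'v::complex_vector \<Rightarrow> 'v \<Rightarrow> complex"
  assumes add_left: "s (x + y) z = s x z + s y z"
    and add_right: "s x (y + z) = s x y + s x z"
    and scaleC_left: "s (c *\<^sub>C x) y = cnj c * s x y"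
    and scaleC_right: "s x (c *\<^sub>C y) = c * s x y"
    and self_nonneg: "s x x \<in> \<real>\<^sub>\<ge>\<^sub>0"
begin

lemma self_Im [simp]: "Im (s x x) = 0" and self_Re_nonneg [simp]: "0 \<le> Re (s x x)"
  using self_nonneg[of x] by (simp_all add: complex_nonneg_Reals_iff)

lemma self_add: "s (x + y) (x + y) = s x x + s x y + s y x + s y y"
  by (simp add: add_left add_right)

text \<open>Polarization: the values of the form at \<open>x + y\<close> and \<open>x + \<i> y\<close> are real, which determines the
imaginary and the real part of \<open>s y x\<close>.\<close>

lemma hermitian: "s y x = cnj (s x y)"
proof -
  have "Im (s x y + s y x) = 0"
    using self_Im[of "x + y"] by (simp add: self_add)
  moreover have "Im (\<i> * s x y - \<i> * s y x) = 0"
    using self_Im[of "x + \<i> *\<^sub>C y"] by (simp add: self_add scaleC_left scaleC_right)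
  ultimately show ?thesis
    by (simp add: complex_eq_iff)
qed

lemma Re_self_add_scaleC:
  "Re (s (x + c *\<^sub>C y) (x + c *\<^sub>C y)) = Re (s x x) + 2 * Re (c * s x y) + (cmod c)\<^sup>2 * Re (s y y)"
  unfolding cmod_power2
  by (simp add: self_add scaleC_left scaleC_right hermitian[of y x] power2_eq_square algebra_simps)

text \<open>The form is nonnegative at \<open>x - r (cnj (s x y)) y\<close> for every real \<open>r\<close>. If \<open>s y y > 0\<close>,
the minimum over \<open>r\<close>, at \<open>1 / s y y\<close>, gives the claim; if \<open>s y y = 0\<close>, the expression is affine in
\<open>r\<close> and can be nonnegative for all \<open>r\<close> only if \<open>s x y = 0\<close>.\<close>

lemma Cauchy_Schwarz: "(cmod (s x y))\<^sup>2 \<le> Re (s x x) * Re (s y y)"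
proof -
  define a b w where "a = Re (s x x)" and "b = Re (s y y)" and "w = (cmod (s x y))\<^sup>2"
  have "b \<ge> 0" "w \<ge> 0" "a \<ge> 0"
    by (simp_all add: a_def b_def w_def)
  have quad: "0 \<le> a - 2 * r * w + r\<^sup>2 * w * b" for r :: real
  proof -
    let ?c = "- (of_real r * cnj (s x y))"
    have "?c * s x y = - of_real (r * w)"
      using complex_norm_square[of "s x y"] by (simp add: w_def mult_ac)
    then have "Re (?c * s x y) = - (r * w)"
      by (metis Re_complex_of_real of_real_minus)
    moreover have "(cmod ?c)\<^sup>2 = r\<^sup>2 * w"
      by (simp add: norm_mult power_mult_distrib w_def)
    ultimately show ?thesis
      using Re_self_add_scaleC[of x ?c y] self_Re_nonneg[of "x + ?c *\<^sub>C y"]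
      by (simp add: a_def b_def)
  qed
  show ?thesis
  proof (cases "b = 0")
    case True
    have "w = 0"
    proof (rule ccontr)
      assume "w \<noteq> 0"
      then show False
        using quad[of "(a + 1) / w"] True \<open>a \<ge> 0\<close> by simp
    qed
    then show ?thesis
      using True by (simp add: w_def b_def)
  next
    case False
    then have "b > 0"
      using \<open>b \<ge> 0\<close> by simp
    then have "w \<le> a * b"
      using quad[of "1 / b"] by (simp add: field_simps power2_eq_square)
    then show ?thesis
      by (simp add: w_def a_def b_def)
  qed
qed

end

text \<open>The abstract counterpart of a state \<open>\<phi>\<close>: the form \<open>\<phi> (ip x y)\<close> is bounded on the diagonal by the
squared norm.\<close>

locale contractive_form = positive_form s
  for s :: "'v::complex_normed_vector \<Rightarrow> 'v \<Rightarrow> complex" +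
  assumes self_le_norm: "Re (s x x) \<le> (norm x)\<^sup>2"
begin

lemma cmod_le_norm: "cmod (s x y) \<le> norm x * norm y"
proof (rule power2_le_imp_le)
  have "(cmod (s x y))\<^sup>2 \<le> Re (s x x) * Re (s y y)"
    by (rule Cauchy_Schwarz)
  also have "\<dots> \<le> (norm x)\<^sup>2 * (norm y)\<^sup>2"
    by (intro mult_mono self_le_norm) simp_all
  finally show "(cmod (s x y))\<^sup>2 \<le> (norm x * norm y)\<^sup>2"
    by (simp add: power_mult_distrib)
qed simp

text \<open>Equality in Cauchy-Schwarz makes the form agree with the squared norm at \<open>x\<close> and at \<open>y\<close>. Rotating
\<open>y\<close> by the phase of \<open>s x y\<close> then makes the form at the sum as large as the triangle inequality
permits.\<close>

lemma norm_parallel_if_norming: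
  assumes "cmod (s x y) = norm x * norm y"
  shows "x \<parallel> y"
proof (cases "x = 0 \<or> y = 0")
  case True
  then show ?thesis
    unfolding norm_parallel_def by (intro exI[of _ 1]) (auto simp: scaleC_one)
next
  case False
  define c where "c = cnj (s x y) / cmod (s x y)"
  have nz: "s x y \<noteq> 0"
    using False assms by auto
  have "cmod c = 1" and c: "c * s x y = cmod (s x y)"
    using nz complex_norm_square[of "s x y"]
    by (simp_all add: c_def norm_divide field_simps power2_eq_square)
  have prod: "(norm x)\<^sup>2 * (norm y)\<^sup>2 \<le> Re (s x x) * Re (s y y)"
    using Cauchy_Schwarz[of x y] assms by (simp add: power_mult_distrib)
  have "(norm x)\<^sup>2 * (norm y)\<^sup>2 \<le> Re (s x x) * (norm y)\<^sup>2"
    by (rule order.trans[OF prod]) (intro mult_left_mono self_le_norm, simp)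
  then have x: "(norm x)\<^sup>2 \<le> Re (s x x)"
    using False by simp
  have "(norm x)\<^sup>2 * (norm y)\<^sup>2 \<le> (norm x)\<^sup>2 * Re (s y y)"
    by (rule order.trans[OF prod]) (intro mult_right_mono self_le_norm, simp)
  then have y: "(norm y)\<^sup>2 \<le> Re (s y y)"
    using False by simp
  have "(norm x + norm y)\<^sup>2 \<le> Re (s (x + c *\<^sub>C y) (x + c *\<^sub>C y))"
    using x y by (simp add: Re_self_add_scaleC c \<open>cmod c = 1\<close> assms power2_sum)
  also have "\<dots> \<le> (norm (x + c *\<^sub>C y))\<^sup>2"
    by (rule self_le_norm)
  finally have "norm x + norm y \<le> norm (x + c *\<^sub>C y)"
    by (rule power2_le_imp_le) simp
  moreover have "norm (x + c *\<^sub>C y) \<le> norm x + norm y"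
    using norm_triangle_ineq[of x "c *\<^sub>C y"] by (simp add: norm_scaleC \<open>cmod c = 1\<close>)
  ultimately show ?thesis
    unfolding norm_parallel_def using \<open>cmod c = 1\<close> by (intro exI[of _ c]) simp
qed

text \<open>If \<open>s\<close> attains its bound at a sum whose norm is the sum of the norms, then none of the estimates
\<open>s x x \<le> (norm x)\<^sup>2\<close>, \<open>s y y \<le> (norm y)\<^sup>2\<close> and \<open>Re (c * s x y) \<le> norm x * norm y\<close> can be strict.\<close>

lemma norming_if_norm_add:
  assumes c: "cmod c = 1" and norm: "norm (x + c *\<^sub>C y) = norm x + norm y"
    and attained: "Re (s (x + c *\<^sub>C y) (x + c *\<^sub>C y)) = (norm (x + c *\<^sub>C y))\<^sup>2"
  shows "cmod (s x y) = norm x * norm y"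
proof -
  have "(norm x + norm y)\<^sup>2 = Re (s x x) + 2 * Re (c * s x y) + Re (s y y)"
    using attained by (simp add: norm Re_self_add_scaleC c)
  also have "\<dots> \<le> (norm x)\<^sup>2 + 2 * cmod (s x y) + (norm y)\<^sup>2"
    using self_le_norm[of x] self_le_norm[of y] complex_Re_le_cmod[of "c * s x y"]
    by (simp add: norm_mult c)
  finally have "norm x * norm y \<le> cmod (s x y)"
    by (simp add: power2_sum)
  then show ?thesis
    using cmod_le_norm[of x y] by simp
qed

end

section \<open>The inner product\<close>

interpretation cinner: contractive_form "cinner :: 'h::complex_hilbert_space \<Rightarrow> 'h \<Rightarrow> complex"
proof
  fix x y z :: 'h and c
  show "cinner (x + y) z = cinner x z + cinner y z"
    by (metis cinner_add_right cinner_commute complex_cnj_add)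
  show "cinner (c *\<^sub>C x) y = cnj c * cinner x y"
    by (metis cinner_scaleC_right cinner_commute complex_cnj_mult)
  show "cinner x x \<in> \<real>\<^sub>\<ge>\<^sub>0"
    by (rule cinner_self_nonneg)
  then show "Re (cinner x x) \<le> (norm x)\<^sup>2"
    by (simp add: norm_eq_sqrt_cinner complex_nonneg_Reals_iff)
qed (simp_all add: cinner_add_right cinner_scaleC_right)

lemma cinner_self: "cinner h h = complex_of_real ((norm h)\<^sup>2)"
  for h :: "'h::complex_hilbert_space"
  by (simp add: complex_eq_iff norm_eq_sqrt_cinner)

text \<open>Bilinearity is over the reals; it makes the inner product available to the theory of limits and
infinite sums.\<close>

lemma bounded_bilinear_cinner:
  "bounded_bilinear (cinner :: 'h::complex_hilbert_space \<Rightarrow> 'h \<Rightarrow> complex)"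
proof
  show "\<exists>K. \<forall>a b. norm (cinner a b :: complex) \<le> norm (a :: 'h) * norm b * K"
    by (intro exI[of _ 1]) (simp add: cinner.cmod_le_norm)
qed (simp_all add: cinner.add_left cinner.add_right cinner.scaleC_left cinner.scaleC_right
    scaleR_scaleC scaleC_complex_def)

interpretation bicinner: bounded_bilinear "cinner :: 'h::complex_hilbert_space \<Rightarrow> 'h \<Rightarrow> complex"
  by (rule bounded_bilinear_cinner)

lemma norm_diff_cinner:
  "(norm (g - h))\<^sup>2 = (norm g)\<^sup>2 - 2 * Re (cinner g h) + (norm h)\<^sup>2"
  for g h :: "'h::complex_hilbert_space"
proof -
  have "cinner (g - h) (g - h) = cinner g g - cinner g h - cnj (cinner g h) + cinner h h"
    by (simp add: bicinner.diff_left bicinner.diff_right cinner_commute[of h g])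
  from arg_cong[OF this, of Re] show ?thesis
    by (simp add: cinner_self)
qed

lemma cinner_eqI: "(\<And>g. cinner g h = cinner g k) \<Longrightarrow> h = k" for h :: "'h::complex_hilbert_space"
proof -
  assume "\<And>g. cinner g h = cinner g k"
  then have "cinner (h - k) (h - k) = 0"
    by (simp add: bicinner.diff_right)
  then show "h = k"
    by (simp add: cinner_self)
qed

section \<open>Orthonormal bases\<close>

definition orthonormal_set :: "'h::complex_hilbert_space set \<Rightarrow> bool"
  where "orthonormal_set B \<longleftrightarrow> (\<forall>e\<in>B. \<forall>f\<in>B. cinner e f = (if e = f then 1 else 0))"

lemma orthonormal_setD:
  "orthonormal_set B \<Longrightarrow> e \<in> B \<Longrightarrow> f \<in> B \<Longrightarrow> cinner e f = (if e = f then 1 else 0)"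
  by (simp add: orthonormal_set_def)

lemma cinner_orthonormal_sum:
  assumes "orthonormal_set B" "finite F" "F \<subseteq> B" "e \<in> B"
  shows "cinner e (\<Sum>f\<in>F. c f *\<^sub>C f) = (if e \<in> F then c e else 0)"
proof -
  have "cinner e (\<Sum>f\<in>F. c f *\<^sub>C f) = (\<Sum>f\<in>F. if e = f then c f else 0)"
    unfolding bicinner.sum_right
    using assms by (intro sum.cong) (auto simp: cinner.scaleC_right orthonormal_setD)
  also have "\<dots> = (if e \<in> F then c e else 0)"
    using assms(2) by simp
  finally show ?thesis .
qed

lemma norm_orthonormal_sum:
  assumes "orthonormal_set B" "finite F" "F \<subseteq> B"
  shows "(norm (\<Sum>f\<in>F. c f *\<^sub>C f))\<^sup>2 = (\<Sum>f\<in>F. (cmod (c f))\<^sup>2)"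
proof -
  let ?v = "\<Sum>f\<in>F. c f *\<^sub>C f"
  have "cinner ?v ?v = (\<Sum>e\<in>F. cnj (c e) * cinner e ?v)"
    by (subst bicinner.sum_left) (simp add: cinner.scaleC_left)
  also have "\<dots> = (\<Sum>e\<in>F. complex_of_real ((cmod (c e))\<^sup>2))"
    using assms(3) complex_norm_square
    by (intro sum.cong) (auto simp: cinner_orthonormal_sum[OF assms] subsetD mult_ac)
  finally have "complex_of_real ((norm ?v)\<^sup>2) = complex_of_real (\<Sum>f\<in>F. (cmod (c f))\<^sup>2)"
    by (simp add: cinner_self)
  then show ?thesis
    by (simp only: of_real_eq_iff)
qed

text \<open>By Pythagoras, the distance of two partial sums that contain a common finite set is controlled by
a tail of the scalar series, so the net of partial sums is Cauchy.\<close>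

lemma orthonormal_summable:
  assumes B: "orthonormal_set B" and c: "(\<lambda>e. (cmod (c e))\<^sup>2) summable_on B"
  shows "(\<lambda>e. c e *\<^sub>C e) summable_on B"
proof -
  define S where "S F = (\<Sum>e\<in>F. c e *\<^sub>C e)" for F
  define q where "q F = (\<Sum>e\<in>F. (cmod (c e))\<^sup>2)" for F
  define L where "L = (\<Sum>\<^sub>\<infinity>e\<in>B. (cmod (c e))\<^sup>2)"
  have q_le: "q F \<le> L" if "finite F" "F \<subseteq> B" for F
    unfolding q_def L_def using that c by (intro finite_sum_le_infsum) auto
  have "\<exists>P. eventually P (finite_subsets_at_top B) \<and>
      (\<forall>F F'. P F \<and> P F' \<longrightarrow> dist (S F) (S F') < \<epsilon>)" if "\<epsilon> > 0" for \<epsilon>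
  proof -
    obtain F0 where F0: "finite F0" "F0 \<subseteq> B" "dist (q F0) L \<le> (\<epsilon> / 3)\<^sup>2"
      using has_sum_finite_approximation[OF has_sum_infsum[OF c], of "(\<epsilon> / 3)\<^sup>2"] \<open>\<epsilon> > 0\<close>
      unfolding q_def L_def by auto
    have near: "dist (S F) (S F0) \<le> \<epsilon> / 3" if F: "finite F" "F \<subseteq> B" "F0 \<subseteq> F" for F
    proof (rule power2_le_imp_le)
      have "(dist (S F) (S F0))\<^sup>2 = (norm (S (F - F0)))\<^sup>2"
        unfolding S_def dist_norm using F F0 by (subst sum_diff) auto
      also have "\<dots> = q (F - F0)"
        unfolding S_def q_def using F by (intro norm_orthonormal_sum[OF B]) auto
      also have "\<dots> = q F - q F0"
        unfolding q_def using F F0 by (subst sum_diff) auto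
      also have "\<dots> \<le> L - q F0"
        using q_le F by simp
      finally show "(dist (S F) (S F0))\<^sup>2 \<le> (\<epsilon> / 3)\<^sup>2"
        using F0(3) q_le[OF F0(1,2)] by (simp add: dist_real_def)
    qed (use \<open>\<epsilon> > 0\<close> in simp)
    have "dist (S F) (S F') < \<epsilon>"
      if "finite F \<and> F \<subseteq> B \<and> F0 \<subseteq> F" "finite F' \<and> F' \<subseteq> B \<and> F0 \<subseteq> F'" for F F'
    proof -
      have "dist (S F) (S F0) \<le> \<epsilon> / 3" "dist (S F') (S F0) \<le> \<epsilon> / 3"
        using near that by blast+
      then show ?thesis
        using dist_triangle2[of "S F" "S F'" "S F0"] \<open>\<epsilon> > 0\<close> by linarith
    qed
    moreover have "\<forall>\<^sub>F F in finite_subsets_at_top B. finite F \<and> F \<subseteq> B \<and> F0 \<subseteq> F"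
      unfolding eventually_finite_subsets_at_top using F0(1,2) by (intro exI[of _ F0]) simp
    ultimately show ?thesis
      by (intro exI[of _ "\<lambda>F. finite F \<and> F \<subseteq> B \<and> F0 \<subseteq> F"] conjI allI impI) simp_all
  qed
  then have "cauchy_filter (filtermap S (finite_subsets_at_top B))"
    by (simp add: cauchy_filter_metric_filtermap)
  moreover have "complete (UNIV :: 'a set)"
    by (meson Cauchy_convergent UNIV_I complete_def convergent_def)
  ultimately obtain v where "(S \<longlongrightarrow> v) (finite_subsets_at_top B)"
    using complete_uniform[where S = UNIV] by (force simp add: filterlim_def)
  then show ?thesis
    unfolding summable_on_def has_sum_def S_def by blast
qed

text \<open>The projection \<open>v\<close> of \<open>h\<close> to the span of \<open>F\<close> satisfies \<open>(norm h)\<^sup>2 - (norm v)\<^sup>2 = (norm (v - h))\<^sup>2\<close>.\<close>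

lemma Bessel:
  assumes B: "orthonormal_set B" and F: "finite F" "F \<subseteq> B"
  shows "(\<Sum>e\<in>F. (cmod (cinner e h))\<^sup>2) \<le> (norm h)\<^sup>2"
proof -
  define v where "v = (\<Sum>e\<in>F. cinner e h *\<^sub>C e)"
  have "cinner v h = (\<Sum>e\<in>F. cnj (cinner e h) * cinner e h)"
    unfolding v_def by (subst bicinner.sum_left) (simp add: cinner.scaleC_left)
  also have "\<dots> = complex_of_real (\<Sum>e\<in>F. (cmod (cinner e h))\<^sup>2)"
    using complex_norm_square by (simp add: mult_ac)
  also have "(\<Sum>e\<in>F. (cmod (cinner e h))\<^sup>2) = (norm v)\<^sup>2"
    unfolding v_def using norm_orthonormal_sum[OF B F] by simp
  finally have "(norm (v - h))\<^sup>2 = (norm h)\<^sup>2 - (norm v)\<^sup>2"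
    by (simp add: norm_diff_cinner)
  then have "(norm v)\<^sup>2 \<le> (norm h)\<^sup>2"
    using zero_le_power2[of "norm (v - h)"] by linarith
  then show ?thesis
    unfolding v_def using norm_orthonormal_sum[OF B F] by simp
qed

lemma orthonormal_basis_iff:
  "orthonormal_basis B \<longleftrightarrow> orthonormal_set B \<and> (\<forall>h. (\<forall>e\<in>B. cinner e h = 0) \<longrightarrow> h = 0)"
  by (simp add: orthonormal_basis_def orthonormal_set_def)

text \<open>A maximal orthonormal set, which exists by Zorn's lemma, is a basis: a nonzero vector orthogonal
to it could be normalized and added.\<close>

lemma ex_orthonormal_basis: "\<exists>B :: 'h::complex_hilbert_space set. orthonormal_basis B"
proof -
  let ?O = "{B :: 'h set. orthonormal_set B}"
  have "\<exists>B\<in>?O. \<forall>X\<in>?O. B \<subseteq> X \<longrightarrow> X = B"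
  proof (rule subset_Zorn')
    fix C assume C: "subset.chain ?O C"
    show "\<Union>C \<in> ?O"
      unfolding orthonormal_set_def mem_Collect_eq
    proof (intro ballI)
      fix e f assume "e \<in> \<Union>C" "f \<in> \<Union>C"
      then obtain X Y where XY: "X \<in> C" "Y \<in> C" "e \<in> X" "f \<in> Y"
        by blast
      then have "X \<subseteq> Y \<or> Y \<subseteq> X" "orthonormal_set X" "orthonormal_set Y"
        using C by (auto simp: subset_chain_def)
      then show "cinner e f = (if e = f then 1 else 0)"
        using XY by (blast intro: orthonormal_setD)
    qed
  qed
  then obtain B where "B \<in> ?O" and "\<forall>X\<in>?O. B \<subseteq> X \<longrightarrow> X = B"
    by (rule bexE)
  then have B: "orthonormal_set B"
    and max: "\<And>X. orthonormal_set X \<Longrightarrow> B \<subseteq> X \<Longrightarrow> X = B"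
    by simp_all
  have "h = 0" if h: "\<forall>e\<in>B. cinner e h = 0" for h
  proof (rule ccontr)
    assume "h \<noteq> 0"
    define u where "u = complex_of_real (1 / norm h) *\<^sub>C h"
    have "norm u = 1"
      using \<open>h \<noteq> 0\<close> by (simp add: u_def norm_scaleC norm_divide)
    then have "cinner u u = 1"
      by (simp add: cinner_self)
    moreover have "cinner e u = 0" "cinner u e = 0" if "e \<in> B" for e
      using h that cinner_commute[of h e]
      by (simp_all add: u_def cinner.scaleC_left cinner.scaleC_right)
    ultimately have "orthonormal_set (insert u B)"
      using B by (auto simp: orthonormal_set_def)
    then have "u \<in> B"
      using max[of "insert u B"] by blast
    then show False
      using \<open>cinner u u = 1\<close> \<open>\<And>e. e \<in> B \<Longrightarrow> cinner e u = 0\<close> by force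
  qed
  then show ?thesis
    unfolding orthonormal_basis_iff using B by blast
qed

lemma orthonormal_basis_some_basis: "orthonormal_basis some_basis"
  unfolding some_basis_def by (rule someI_ex[OF ex_orthonormal_basis])

lemma orthonormal_set_some_basis: "orthonormal_set some_basis"
  by (rule orthonormal_basis_some_basis[unfolded orthonormal_basis_iff, THEN conjunct1])

text \<open>The series converges by Bessel's inequality, and the difference between \<open>h\<close> and its sum is
orthogonal to every basis vector.\<close>

lemma basis_expansion: "((\<lambda>e. cinner e h *\<^sub>C e) has_sum h) some_basis"
proof -
  have "(\<lambda>e. (cmod (cinner e h))\<^sup>2) summable_on some_basis"
    using Bessel[OF orthonormal_set_some_basis]
    by (intro nonneg_bdd_above_summable_on bdd_aboveI2[where M = "(norm h)\<^sup>2"]) auto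
  then have "(\<lambda>e. cinner e h *\<^sub>C e) summable_on some_basis"
    by (rule orthonormal_summable[OF orthonormal_set_some_basis])
  then obtain k where k: "((\<lambda>e. cinner e h *\<^sub>C e) has_sum k) some_basis"
    unfolding summable_on_def by blast
  have "cinner f (h - k) = 0" if f: "f \<in> some_basis" for f
  proof -
    have "((\<lambda>e. cinner f (cinner e h *\<^sub>C e)) has_sum cinner f k) some_basis"
      by (rule has_sum_bounded_linear[OF bicinner.bounded_linear_right k])
    moreover have "((\<lambda>e. cinner f (cinner e h *\<^sub>C e)) has_sum cinner f h) some_basis"
      by (rule has_sum_finite_neutralI[of "{f}"])
        (use f in \<open>auto simp: cinner.scaleC_right orthonormal_setD[OF orthonormal_set_some_basis]\<close>)
    ultimately have "cinner f k = cinner f h"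
      by (rule has_sum_unique)
    then show ?thesis
      by (simp add: bicinner.diff_right)
  qed
  then have "h - k = 0"
    using orthonormal_basis_some_basis unfolding orthonormal_basis_iff by blast
  then show ?thesis
    using k by simp
qed

lemma Parseval: "((\<lambda>e. cinner g e * cinner e h) has_sum cinner g h) some_basis"
  using has_sum_bounded_linear[OF bicinner.bounded_linear_right basis_expansion, of g h]
  by (simp add: cinner.scaleC_right mult.commute)

lemma Parseval_norm: "((\<lambda>e. (cmod (cinner e h))\<^sup>2) has_sum (norm h)\<^sup>2) some_basis"
proof -
  have "cinner h e * cinner e h = complex_of_real ((cmod (cinner e h))\<^sup>2)" for e
    using complex_norm_square[of "cinner e h"] cinner_commute[of h e] by (simp add: mult.commute)
  then have "((\<lambda>e. complex_of_real ((cmod (cinner e h))\<^sup>2)) has_sum complex_of_real ((norm h)\<^sup>2))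
      some_basis"
    using Parseval[of h h] by (simp only: cinner_self)
  then show ?thesis
    by (simp only: has_sum_of_real_iff)
qed

section \<open>Adjoints\<close>

text \<open>The representing vector has the coordinates \<open>cnj (f e)\<close>. These are square-summable: for a finite
part \<open>v\<close> of the series, \<open>f v = (norm v)\<^sup>2\<close>, so that \<open>norm v\<close> is at most the bound of \<open>f\<close>.\<close>

lemma Riesz:
  fixes f :: "'h::complex_hilbert_space \<Rightarrow> complex"
  assumes f: "bounded_linear f" and hom: "\<And>c h. f (c *\<^sub>C h) = c * f h"
  shows "\<exists>g. \<forall>h. f h = cinner g h"
proof -
  interpret f: bounded_linear f by (rule f)
  obtain K where K: "\<And>h. cmod (f h) \<le> norm h * K" "K \<ge> 0"
    using f.nonneg_bounded by auto
  have bound: "(\<Sum>e\<in>F. (cmod (f e))\<^sup>2) \<le> K\<^sup>2" if F: "finite F" "F \<subseteq> some_basis" for F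
  proof -
    define v where "v = (\<Sum>e\<in>F. cnj (f e) *\<^sub>C e)"
    define q where "q = (\<Sum>e\<in>F. (cmod (f e))\<^sup>2)"
    have v: "(norm v)\<^sup>2 = q"
      using norm_orthonormal_sum[OF orthonormal_set_some_basis F, of "\<lambda>e. cnj (f e)"]
      by (simp add: v_def q_def)
    have "f v = (\<Sum>e\<in>F. cnj (f e) * f e)"
      by (simp add: v_def f.sum hom)
    also have "\<dots> = complex_of_real q"
      using complex_norm_square by (simp add: q_def mult.commute)
    finally have "f v = complex_of_real ((norm v)\<^sup>2)"
      by (simp only: v)
    then have "norm v * norm v \<le> norm v * K"
      using K(1)[of v] by (simp add: power2_eq_square norm_mult)
    then have "norm v \<le> K"
      using K(2) by (cases "v = 0") auto
    then show ?thesis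
      using power_mono[of "norm v" K 2] v by (simp add: q_def)
  qed
  have "(\<lambda>e. (cmod (cnj (f e)))\<^sup>2) summable_on some_basis"
    using bound
    by (intro nonneg_bdd_above_summable_on bdd_aboveI2[where M = "K\<^sup>2"]) auto
  then have "(\<lambda>e. cnj (f e) *\<^sub>C e) summable_on some_basis"
    by (rule orthonormal_summable[OF orthonormal_set_some_basis])
  then obtain g where g: "((\<lambda>e. cnj (f e) *\<^sub>C e) has_sum g) some_basis"
    unfolding summable_on_def by blast
  have "f h = cinner g h" for h
  proof (rule has_sum_unique)
    show "((\<lambda>e. f (cinner e h *\<^sub>C e)) has_sum f h) some_basis"
      by (rule has_sum_bounded_linear[OF f basis_expansion])
    show "((\<lambda>e. f (cinner e h *\<^sub>C e)) has_sum cinner g h) some_basis"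
      using has_sum_bounded_linear[OF bicinner.bounded_linear_left g, of h]
      by (simp add: hom cinner.scaleC_left mult.commute)
  qed
  then show ?thesis
    by blast
qed

lemma complex_linear_opD: "complex_linear_op T \<Longrightarrow> T (c *\<^sub>C h) = c *\<^sub>C T h"
  by (simp add: complex_linear_op_def)

text \<open>The defining property of the adjoint determines it, so the description operator can be evaluated.\<close>

lemma adj_eqI:
  fixes S T :: "'h::complex_hilbert_space \<Rightarrow>\<^sub>L 'h"
  assumes "\<And>g h. cinner (S g) h = cinner g (T h)"
  shows "adj T = S"
  unfolding adj_def
proof (rule the_equality)
  fix R :: "'h \<Rightarrow>\<^sub>L 'h" assume R: "\<forall>g h. cinner (R g) h = cinner g (T h)"
  show "R = S"
  proof (rule blinfun_eqI, rule cinner_eqI)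
    fix g h
    show "cinner h (R g) = cinner h (S g)"
      using R assms by (metis cinner_commute)
  qed
qed (use assms in simp)

text \<open>Existence of the adjoint: Riesz' theorem represents \<open>h \<mapsto> cinner g (T h)\<close> by a vector, which depends
linearly and boundedly on \<open>g\<close>.\<close>

lemma cinner_adj:
  fixes T :: "'h::complex_hilbert_space \<Rightarrow>\<^sub>L 'h"
  assumes T: "complex_linear_op T"
  shows "cinner (adj T g) h = cinner g (T h)"
proof -
  have "\<exists>k. \<forall>h. cinner g (T h) = cinner k h" for g
  proof (rule Riesz)
    show "bounded_linear (\<lambda>h. cinner g (T h))"
      by (rule bounded_linear_compose[OF bicinner.bounded_linear_right])
        (rule blinfun.bounded_linear_right)
  qed (simp add: complex_linear_opD[OF T] cinner.scaleC_right)
  then obtain S where S: "\<And>g h. cinner g (T h) = cinner (S g) h"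
    by metis
  have S': "cinner h (S g) = cinner (T h) g" for g h
    by (metis S cinner_commute)
  have "bounded_linear S"
  proof (rule bounded_linear_intro[where K = "norm T"])
    show "S (g + k) = S g + S k" "S (r *\<^sub>R g) = r *\<^sub>R S g" for g k r
      by (rule cinner_eqI; simp add: S' bicinner.add_right bicinner.scaleR_right)+
    show "norm (S g) \<le> norm g * norm T" for g
    proof -
      have "(norm (S g))\<^sup>2 = cmod (cinner (S g) (S g))"
        unfolding cinner_self norm_of_real by simp
      also have "\<dots> = cmod (cinner g (T (S g)))"
        by (simp add: S)
      also have "\<dots> \<le> norm g * (norm T * norm (S g))"
        by (rule order.trans[OF cinner.cmod_le_norm]) (intro mult_left_mono norm_blinfun, simp)
      finally show ?thesis
        by (cases "S g = 0") (simp_all add: power2_eq_square mult.assoc[symmetric])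
    qed
  qed
  then have "adj T = Blinfun S"
    by (intro adj_eqI) (simp add: bounded_linear_Blinfun_apply S)
  then show ?thesis
    using \<open>bounded_linear S\<close> by (simp add: bounded_linear_Blinfun_apply S)
qed

section \<open>Square roots of positive operators\<close>

lemma positive_form_of_op:
  assumes "positive_op T"
  shows "positive_form (\<lambda>g h. cinner g (T h))"
  using assms unfolding positive_op_def
  by unfold_locales
    (simp_all add: cinner.add_left cinner.scaleC_left cinner.add_right cinner.scaleC_right
      blinfun.add_right complex_linear_opD)

lemma positive_op_selfadjoint: "positive_op T \<Longrightarrow> cinner (T g) h = cinner g (T h)"
  using positive_form.hermitian[OF positive_form_of_op] cinner_commute by metis

text \<open>The iteration converges to a solution \<open>Y\<close> of \<open>Y = (X + Y\<^sup>2) / 2\<close>, that is of \<open>(1 - Y)\<^sup>2 = 1 - X\<close>. All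
iterates are polynomials in \<open>X\<close> with nonnegative coefficients, so for \<open>norm X \<le> 1\<close> they and their
successive differences are dominated by the same iteration for the number \<open>1\<close>.\<close>

fun sqrt_iter :: "('h::real_normed_vector \<Rightarrow>\<^sub>L 'h) \<Rightarrow> nat \<Rightarrow> 'h \<Rightarrow>\<^sub>L 'h" where
  "sqrt_iter X 0 = 0"
| "sqrt_iter X (Suc n) = (1/2) *\<^sub>R (X + (sqrt_iter X n o\<^sub>L sqrt_iter X n))"

fun sqrt_iter_bound :: "nat \<Rightarrow> real" where
  "sqrt_iter_bound 0 = 0"
| "sqrt_iter_bound (Suc n) = (1 + (sqrt_iter_bound n)\<^sup>2) / 2"

lemma sqrt_iter_bound_range: "0 \<le> sqrt_iter_bound n \<and> sqrt_iter_bound n \<le> 1"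
  by (induction n) (auto simp: power_le_one)

lemma sqrt_iter_bound_step: "sqrt_iter_bound n \<le> sqrt_iter_bound (Suc n)"
proof -
  have "0 \<le> (1 - sqrt_iter_bound n)\<^sup>2"
    by simp
  then show ?thesis
    by (simp add: power2_diff)
qed

lemma sqrt_iter_commutes:
  assumes "Z o\<^sub>L X = X o\<^sub>L Z"
  shows "Z o\<^sub>L sqrt_iter X n = sqrt_iter X n o\<^sub>L Z"
proof (induction n)
  case (Suc n)
  have X: "Z (X h) = X (Z h)" for h
    using arg_cong[OF assms, of "\<lambda>S. blinfun_apply S h"] by simp
  have I: "Z (sqrt_iter X n h) = sqrt_iter X n (Z h)" for h
    using arg_cong[OF Suc, of "\<lambda>S. blinfun_apply S h"] by simp
  show ?case
    by (rule blinfun_eqI)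
      (simp add: blinfun.add_left blinfun.add_right blinfun.scaleR_left blinfun.scaleR_right X I)
qed (simp add: blinfun_eqI)

lemma sqrt_iter_commute: "sqrt_iter X m o\<^sub>L sqrt_iter X n = sqrt_iter X n o\<^sub>L sqrt_iter X m"
  by (rule sqrt_iter_commutes) (simp add: sqrt_iter_commutes)

lemma norm_sqrt_iter:
  assumes X: "norm X \<le> 1"
  shows "norm (sqrt_iter X n) \<le> sqrt_iter_bound n"
proof (induction n)
  case (Suc n)
  have "norm (sqrt_iter X n o\<^sub>L sqrt_iter X n) \<le> (sqrt_iter_bound n)\<^sup>2"
    unfolding power2_eq_square using Suc sqrt_iter_bound_range[of n]
    by (intro order.trans[OF norm_blinfun_compose] mult_mono) auto
  then have "norm (X + (sqrt_iter X n o\<^sub>L sqrt_iter X n)) \<le> 1 + (sqrt_iter_bound n)\<^sup>2"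
    using X by (intro norm_triangle_mono)
  then show ?case
    by simp
qed simp

text \<open>Since iterates commute, \<open>Z\<^sup>2 - Y\<^sup>2 = (Z + Y) (Z - Y)\<close> for successive iterates \<open>Y\<close> and \<open>Z\<close>, and the
same factorization holds for the dominating numbers.\<close>

lemma norm_sqrt_iter_step:
  assumes X: "norm X \<le> 1"
  shows "norm (sqrt_iter X (Suc n) - sqrt_iter X n) \<le> sqrt_iter_bound (Suc n) - sqrt_iter_bound n"
proof (induction n)
  case 0
  then show ?case
    using X by simp
next
  case (Suc n)
  define Y Z where "Y = sqrt_iter X n" and "Z = sqrt_iter X (Suc n)"
  define y z where "y = sqrt_iter_bound n" and "z = sqrt_iter_bound (Suc n)"
  have Z: "Z = (1/2) *\<^sub>R (X + (Y o\<^sub>L Y))"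
    and Z': "sqrt_iter X (Suc (Suc n)) = (1/2) *\<^sub>R (X + (Z o\<^sub>L Z))"
    unfolding Y_def Z_def by (rule sqrt_iter.simps(2))+
  have z: "z = (1 + y\<^sup>2) / 2" and z': "sqrt_iter_bound (Suc (Suc n)) = (1 + z\<^sup>2) / 2"
    unfolding y_def z_def by (rule sqrt_iter_bound.simps(2))+
  have comm: "Z (Y h) = Y (Z h)" for h
    using arg_cong[OF sqrt_iter_commute[of X "Suc n" n], of "\<lambda>S. blinfun_apply S h"]
    by (simp add: Y_def Z_def)
  have "(Z o\<^sub>L Z) - (Y o\<^sub>L Y) = (Z + Y) o\<^sub>L (Z - Y)"
    by (rule blinfun_eqI)
      (simp add: blinfun.add_left blinfun.diff_left blinfun.diff_right comm)
  then have "sqrt_iter X (Suc (Suc n)) - Z = (1/2) *\<^sub>R ((Z + Y) o\<^sub>L (Z - Y))"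
    unfolding Z' by (subst Z) (simp flip: scaleR_diff_right)
  moreover have "norm ((Z + Y) o\<^sub>L (Z - Y)) \<le> (z + y) * (z - y)"
  proof (rule order.trans[OF norm_blinfun_compose], intro mult_mono norm_triangle_mono)
    show "norm Z \<le> z" "norm Y \<le> y"
      unfolding Y_def Z_def y_def z_def by (rule norm_sqrt_iter[OF X])+
    show "norm (Z - Y) \<le> z - y"
      unfolding Y_def Z_def y_def z_def by (rule Suc)
    show "0 \<le> z + y"
      unfolding y_def z_def using sqrt_iter_bound_range by (intro add_nonneg_nonneg) blast+
  qed simp
  moreover have "(z + y) * (z - y) / 2 = sqrt_iter_bound (Suc (Suc n)) - z"
    unfolding z' by (subst (4) z) (simp add: field_simps power2_eq_square)
  ultimately have "norm (sqrt_iter X (Suc (Suc n)) - Z) \<le> sqrt_iter_bound (Suc (Suc n)) - z"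
    by (simp del: sqrt_iter.simps sqrt_iter_bound.simps)
  then show ?case
    by (simp only: Z_def z_def)
qed

lemma sqrt_iter_convergent:
  fixes X :: "'h::banach \<Rightarrow>\<^sub>L 'h"
  assumes X: "norm X \<le> 1"
  shows "convergent (sqrt_iter X)"
proof -
  have "incseq sqrt_iter_bound"
    by (intro incseq_SucI sqrt_iter_bound_step)
  then obtain L where "sqrt_iter_bound \<longlonglongrightarrow> L"
    using incseq_convergent sqrt_iter_bound_range by metis
  then have "summable (\<lambda>n. sqrt_iter_bound (Suc n) - sqrt_iter_bound n)"
    by (rule telescope_summable)
  then have "summable (\<lambda>n. sqrt_iter X (Suc n) - sqrt_iter X n)"
    by (rule summable_comparison_test'[where N = 0]) (rule norm_sqrt_iter_step[OF X])
  then show ?thesis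
    unfolding summable_iff_convergent sum_lessThan_telescope by simp
qed

lemma sqrt_iter_selfadjoint:
  fixes X :: "'h::complex_hilbert_space \<Rightarrow>\<^sub>L 'h"
  assumes "\<And>g h. cinner (X g) h = cinner g (X h)"
  shows "cinner (sqrt_iter X n g) h = cinner g (sqrt_iter X n h)"
  by (induction n arbitrary: g h)
    (simp_all add: blinfun.add_left blinfun.scaleR_left bicinner.scaleR_left bicinner.scaleR_right
      bicinner.zero_left bicinner.zero_right cinner.add_left cinner.add_right assms)

lemma ex_sqrt_one_minus:
  fixes X :: "'h::complex_hilbert_space \<Rightarrow>\<^sub>L 'h"
  assumes X: "norm X \<le> 1" and sa: "\<And>g h. cinner (X g) h = cinner g (X h)"
  shows "\<exists>A :: 'h \<Rightarrow>\<^sub>L 'h. (\<forall>g h. cinner (A g) h = cinner g (A h)) \<and> (\<forall>h. A (A h) = h - X h)"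
proof -
  obtain Y where Y: "sqrt_iter X \<longlonglongrightarrow> Y"
    using sqrt_iter_convergent[OF X] by (auto simp: convergent_def)
  have Yh: "(\<lambda>n. sqrt_iter X n h) \<longlonglongrightarrow> Y h" for h
    by (intro tendsto_intros Y)
  have "(\<lambda>n. sqrt_iter X (Suc n) h) \<longlonglongrightarrow> (1/2) *\<^sub>R (X h + Y (Y h))" for h
    by (simp add: blinfun.add_left blinfun.scaleR_left) (intro tendsto_intros Y Yh)
  then have fixpoint: "Y h = (1/2) *\<^sub>R (X h + Y (Y h))" for h
    using LIMSEQ_unique[OF LIMSEQ_Suc[OF Yh]] by blast
  have Y_sa: "cinner (Y g) h = cinner g (Y h)" for g h
  proof (rule LIMSEQ_unique)
    show "(\<lambda>n. cinner (sqrt_iter X n g) h) \<longlonglongrightarrow> cinner (Y g) h"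
      by (intro bicinner.tendsto Yh tendsto_const)
    show "(\<lambda>n. cinner (sqrt_iter X n g) h) \<longlonglongrightarrow> cinner g (Y h)"
      unfolding sqrt_iter_selfadjoint[OF sa] by (intro bicinner.tendsto Yh tendsto_const)
  qed
  have two: "X h + Y (Y h) = Y h + Y h" for h
    using arg_cong[OF fixpoint[of h], of "scaleR 2"] by (simp add: scaleR_2)
  show ?thesis
  proof (intro exI[of _ "id_blinfun - Y"] conjI allI)
    show "cinner ((id_blinfun - Y) g) h = cinner g ((id_blinfun - Y) h)" for g h
      by (simp add: blinfun.diff_left bicinner.diff_left bicinner.diff_right Y_sa)
    show "(id_blinfun - Y) ((id_blinfun - Y) h) = h - X h" for h
      using two[of h] by (simp add: blinfun.diff_left blinfun.diff_right algebra_simps)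
  qed
qed

text \<open>With \<open>M = norm P\<close>, the operator \<open>X = 1 - P / M\<close> lies between \<open>0\<close> and \<open>1\<close>. Its form is therefore
contractive, which gives \<open>norm X \<le> 1\<close>, and a square root of \<open>1 - X = P / M\<close> can be scaled.\<close>

lemma ex_selfadjoint_sqrt:
  fixes P :: "'h::complex_hilbert_space \<Rightarrow>\<^sub>L 'h"
  assumes P: "positive_op P"
  shows "\<exists>A :: 'h \<Rightarrow>\<^sub>L 'h. A o\<^sub>L A = P \<and> (\<forall>g h. cinner (A g) h = cinner g (A h))"
proof (cases "P = 0")
  case True
  then show ?thesis
    by (intro exI[of _ 0]) (simp add: bicinner.zero_left bicinner.zero_right)
next
  case False
  define M where "M = norm P"
  have "M > 0"
    using False by (simp add: M_def)
  interpret P: positive_form "\<lambda>g h. cinner g (P h)"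
    by (rule positive_form_of_op[OF P])
  define X where "X = id_blinfun - (1/M) *\<^sub>R P"
  have X_apply: "X h = h - (1/M) *\<^sub>R P h" for h
    by (simp add: X_def blinfun.diff_left blinfun.scaleR_left)
  have P_lin: "P (c *\<^sub>C h) = c *\<^sub>C P h" for c h
    using P by (simp add: positive_op_def complex_linear_opD)
  interpret X: contractive_form "\<lambda>g h. cinner g (X h)"
  proof
    fix h k l :: 'h and c
    have "Re (cinner h (P h)) \<le> norm h * norm (P h)"
      using complex_Re_le_cmod cinner.cmod_le_norm order.trans by blast
    also have "\<dots> \<le> norm h * (M * norm h)"
      unfolding M_def by (intro mult_left_mono norm_blinfun) simp
    finally have le: "Re (cinner h (P h)) / M \<le> (norm h)\<^sup>2"
      using \<open>M > 0\<close> by (simp add: field_simps power2_eq_square)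
    have eq: "cinner h (X h) = complex_of_real ((norm h)\<^sup>2 - Re (cinner h (P h)) / M)"
      by (simp add: X_apply bicinner.diff_right bicinner.scaleR_right cinner_self complex_eq_iff)
    show "cinner h (X h) \<in> \<real>\<^sub>\<ge>\<^sub>0"
      using le unfolding eq nonneg_Reals_of_real_iff by simp
    show "Re (cinner h (X h)) \<le> (norm h)\<^sup>2"
      unfolding eq Re_complex_of_real using \<open>M > 0\<close> by simp
    show "cinner h (X (c *\<^sub>C k)) = c * cinner h (X k)"
      by (simp add: X_apply P_lin bicinner.diff_right bicinner.scaleR_right cinner.scaleC_right
          scaleR_conv_of_real algebra_simps)
  qed (simp_all add: cinner.add_left cinner.scaleC_left cinner.add_right blinfun.add_right)
  have "norm X \<le> 1"
  proof (rule norm_blinfun_bound)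
    show "norm (X h) \<le> 1 * norm h" for h
    proof -
      have "(norm (X h))\<^sup>2 = cmod (cinner (X h) (X h))"
        unfolding cinner_self norm_of_real by simp
      also have "\<dots> \<le> norm (X h) * norm h"
        by (rule X.cmod_le_norm)
      finally show ?thesis
        by (cases "X h = 0") (simp_all add: power2_eq_square)
    qed
  qed simp
  moreover have "cinner (X g) h = cinner g (X h)" for g h
    by (simp add: X_apply bicinner.diff_left bicinner.diff_right bicinner.scaleR_left
        bicinner.scaleR_right positive_op_selfadjoint[OF P])
  ultimately obtain A :: "'h \<Rightarrow>\<^sub>L 'h" where A: "\<And>g h. cinner (A g) h = cinner g (A h)"
      "\<And>h. A (A h) = h - X h"
    using ex_sqrt_one_minus by blast
  show ?thesis
  proof (intro exI[of _ "sqrt M *\<^sub>R A"] conjI allI)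
    show "cinner ((sqrt M *\<^sub>R A) g) h = cinner g ((sqrt M *\<^sub>R A) h)" for g h
      by (simp add: blinfun.scaleR_left bicinner.scaleR_left bicinner.scaleR_right A)
    show "(sqrt M *\<^sub>R A) o\<^sub>L (sqrt M *\<^sub>R A) = P"
      using \<open>M > 0\<close>
      by (intro blinfun_eqI)
        (simp add: blinfun.scaleR_left blinfun.scaleR_right A X_apply)
  qed
qed

section \<open>The trace against a positive operator\<close>

text \<open>By Parseval's identity, the coefficients of each \<open>V e\<close> contribute its squared norm. For the image of
the basis under an operator, the total is the squared Hilbert-Schmidt norm.\<close>

lemma summable_square_coefficients:
  assumes V: "(\<lambda>e. (norm (V e))\<^sup>2) summable_on some_basis"
  shows "(\<lambda>(e, f). (cmod (cinner f (V e)))\<^sup>2) summable_on some_basis \<times> some_basis"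
proof (rule summable_on_SigmaI)
  show "((\<lambda>f. case (e, f) of (e, f) \<Rightarrow> (cmod (cinner f (V e)))\<^sup>2) has_sum (norm (V e))\<^sup>2) some_basis"
    for e using Parseval_norm by simp
qed (use V in auto)

text \<open>With \<open>P = A\<^sup>2\<close>, this is the cyclicity \<open>tr (A A T) = tr (A T A)\<close>. Both sides are iterated sums, in
different orders, of \<open>cinner (A e) f * cinner f (A (T e))\<close>. The double series converges absolutely as
a product of two square-summable families, the matrix coefficients of \<open>A\<close> and of \<open>T\<^sup>* A\<close>, so
Fubini's theorem applies.\<close>

lemma trace_compose_positive:
  fixes P :: "'h::complex_hilbert_space \<Rightarrow>\<^sub>L 'h"
  assumes P: "positive_op P" and tr: "tr P \<noteq> 0"
  shows "\<exists>A :: 'h \<Rightarrow>\<^sub>L 'h. ((\<lambda>e. (norm (A e))\<^sup>2) has_sum Re (tr P)) some_basis \<and>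
    (\<forall>T. complex_linear_op T \<longrightarrow> tr (P o\<^sub>L T) = (\<Sum>\<^sub>\<infinity>e\<in>some_basis. cinner (A e) (T (A e))))"
proof -
  obtain A where AA: "A o\<^sub>L A = P" and A: "\<And>g h. cinner (A g) h = cinner g (A h)"
    using ex_selfadjoint_sqrt[OF P] by blast
  have P_eq: "cinner e (P h) = cinner (A e) (A h)" for e h
    unfolding AA[symmetric] by (simp add: A)
  \<comment> \<open>A sum that does not converge has the value 0, so a nonzero trace entails summability.\<close>
  have "(\<lambda>e. cinner e (P e)) summable_on some_basis"
    using tr infsum_not_exists unfolding tr_def by blast
  then have "((\<lambda>e. cinner e (P e)) has_sum tr P) some_basis"
    unfolding tr_def by (rule has_sum_infsum)
  then have sum_A: "((\<lambda>e. (norm (A e))\<^sup>2) has_sum Re (tr P)) some_basis"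
    using has_sum_Re unfolding P_eq cinner_self by fastforce
  then have A_summable: "(\<lambda>e. (norm (A e))\<^sup>2) summable_on some_basis"
    by (rule has_sum_imp_summable)
  have "tr (P o\<^sub>L T) = (\<Sum>\<^sub>\<infinity>e\<in>some_basis. cinner (A e) (T (A e)))" if T: "complex_linear_op T" for T
  proof -
    let ?B = "some_basis :: 'h set"
    define W where "W = adj T o\<^sub>L A"
    have W: "cinner f (A (T e)) = cinner (W f) e" for e f
      by (simp add: W_def cinner_adj[OF T] A)
    have "(norm (W e))\<^sup>2 \<le> (norm (adj T))\<^sup>2 * (norm (A e))\<^sup>2" for e
      unfolding W_def power_mult_distrib[symmetric]
      by (intro power_mono) (simp_all add: norm_blinfun)
    then have W_summable: "(\<lambda>e. (norm (W e))\<^sup>2) summable_on ?B"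
      by (intro summable_on_comparison_test[OF summable_on_cmult_right[OF A_summable]]) auto
    define c where "c e f = cinner (A e) f * cinner f (A (T e))" for e f
    have "(\<lambda>(e, f). c e f) summable_on ?B \<times> ?B"
    proof (rule abs_summable_summable, rule Infinite_Sum.abs_summable_on_comparison_test')
      show "(\<lambda>(e, f). (cmod (cinner f (A e)))\<^sup>2 + (cmod (cinner e (W f)))\<^sup>2) summable_on ?B \<times> ?B"
        using summable_on_add[OF summable_square_coefficients[OF A_summable]
            summable_on_swap[THEN iffD1, OF summable_square_coefficients[OF W_summable]]]
        by (simp add: case_prod_unfold)
      have "cmod (c e f) \<le> (cmod (cinner f (A e)))\<^sup>2 + (cmod (cinner e (W f)))\<^sup>2" for e f
      proof -
        have "cmod (c e f) = cmod (cinner f (A e)) * cmod (cinner e (W f))"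
          unfolding c_def W norm_mult by (metis cinner_commute complex_mod_cnj)
        also have "\<dots> \<le> (cmod (cinner f (A e)))\<^sup>2 + (cmod (cinner e (W f)))\<^sup>2"
          using sum_squares_bound[of "cmod (cinner f (A e))" "cmod (cinner e (W f))"]
            mult_nonneg_nonneg[OF norm_ge_zero[of "cinner f (A e)"] norm_ge_zero[of "cinner e (W f)"]]
          by linarith
        finally show ?thesis .
      qed
      then show "norm (case p of (e, f) \<Rightarrow> c e f)
          \<le> (case p of (e, f) \<Rightarrow> (cmod (cinner f (A e)))\<^sup>2 + (cmod (cinner e (W f)))\<^sup>2)" for p
        by (simp add: case_prod_unfold)
    qed
    then have swap: "(\<Sum>\<^sub>\<infinity>e\<in>?B. \<Sum>\<^sub>\<infinity>f\<in>?B. c e f) = (\<Sum>\<^sub>\<infinity>f\<in>?B. \<Sum>\<^sub>\<infinity>e\<in>?B. c e f)"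
      by (rule infsum_swap_banach)
    have "(\<Sum>\<^sub>\<infinity>f\<in>?B. c e f) = cinner e ((P o\<^sub>L T) e)" for e
      unfolding c_def by (simp add: infsumI[OF Parseval] P_eq)
    moreover have "(\<Sum>\<^sub>\<infinity>e\<in>?B. c e f) = cinner (A f) (T (A f))" for f
    proof -
      have "c e f = cinner (W f) e * cinner e (A f)" for e
        by (simp add: c_def W A)
      then have "(\<Sum>\<^sub>\<infinity>e\<in>?B. c e f) = cinner (W f) (A f)"
        by (simp add: infsumI[OF Parseval])
      then show ?thesis
        by (simp add: W_def cinner_adj[OF T])
    qed
    ultimately show ?thesis
      using swap by (simp add: tr_def)
  qed
  then show ?thesis
    using sum_A by blast
qed

section \<open>Norming vectors of compact positive operators\<close>

text \<open>Cauchy-Schwarz for the form \<open>cinner g (T h)\<close>, applied to \<open>g = T h\<close>.\<close>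

lemma positive_op_norm_bound:
  assumes T: "positive_op T"
  shows "(norm (T h))\<^sup>2 \<le> norm T * Re (cinner h (T h))"
proof (cases "T h = 0")
  case False
  interpret positive_form "\<lambda>g h. cinner g (T h)"
    by (rule positive_form_of_op[OF T])
  have "Re (cinner (T h) (T (T h))) \<le> norm (T h) * norm (T (T h))"
    using complex_Re_le_cmod cinner.cmod_le_norm order.trans by blast
  also have "\<dots> \<le> norm (T h) * (norm T * norm (T h))"
    by (intro mult_left_mono norm_blinfun) simp
  finally have "Re (cinner (T h) (T (T h))) * Re (cinner h (T h))
      \<le> norm (T h) * (norm T * norm (T h)) * Re (cinner h (T h))"
    by (rule mult_right_mono) (rule self_Re_nonneg)
  moreover have "cmod (cinner (T h) (T h)) = (norm (T h))\<^sup>2"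
    unfolding cinner_self norm_of_real by simp
  ultimately have "(norm (T h))\<^sup>2 * (norm (T h))\<^sup>2
      \<le> (norm (T h))\<^sup>2 * (norm T * Re (cinner h (T h)))"
    using Cauchy_Schwarz[of "T h" h] by (simp add: power2_eq_square mult_ac)
  then show ?thesis
    by (rule mult_left_le_imp_le) (use False in simp)
qed (simp add: bicinner.zero_right)

text \<open>On the compact closure of the image of the unit ball, the norm has a maximum at some \<open>k\<close>, and
\<open>norm k = norm T\<close>. If \<open>T (h n)\<close> tends to \<open>k\<close> with \<open>h n\<close> in the unit ball, then \<open>T (h n) - M h n\<close>
with \<open>M = norm T\<close> tends to \<open>0\<close>, because by \<open>positive_op_norm_bound\<close> its squared norm is at most
\<open>M\<^sup>2 - (norm (T (h n)))\<^sup>2\<close>. So \<open>M h n\<close> tends to \<open>k\<close> as well, and \<open>k\<close> is an eigenvector for \<open>M\<close>. For \<open>T = 0\<close> every unit vector serves.\<close>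

lemma compact_positive_op_norming_vector:
  fixes T :: "'h::complex_hilbert_space \<Rightarrow>\<^sub>L 'h"
  assumes compact: "T \<in> compact_ops" and T: "positive_op T" and nontrivial: "\<exists>h::'h. h \<noteq> 0"
  shows "\<exists>h. norm h = 1 \<and> Re (cinner h (T h)) = norm T"
proof (cases "T = 0")
  case True
  obtain h :: 'h where "h \<noteq> 0"
    using nontrivial by blast
  then show ?thesis
    using True by (intro exI[of _ "(1 / norm h) *\<^sub>R h"]) (simp add: bicinner.zero_right)
next
  case False
  define M where "M = norm T"
  have "M > 0"
    using False by (simp add: M_def)
  define K where "K = closure (blinfun_apply T ` cball 0 1)"
  have "compact K"
    using compact by (simp add: compact_ops_def K_def)
  moreover have "T 0 \<in> K"
    unfolding K_def by (intro subsetD[OF closure_subset] imageI) simp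
  ultimately obtain k where k: "k \<in> K" "\<And>l. l \<in> K \<Longrightarrow> norm l \<le> norm k"
    using continuous_attains_sup[of K norm] by (metis continuous_on_norm_id empty_iff)
  have "M \<le> norm k"
    unfolding M_def
  proof (rule norm_blinfun_bound)
    fix h
    show "norm (T h) \<le> norm k * norm h"
    proof (cases "h = 0")
      case False
      have "T ((1 / norm h) *\<^sub>R h) \<in> K"
        unfolding K_def using False by (intro subsetD[OF closure_subset] imageI) simp
      then have "norm (T ((1 / norm h) *\<^sub>R h)) \<le> norm k"
        by (rule k(2))
      then show ?thesis
        using False by (simp add: blinfun.scaleR_right field_simps)
    qed (simp add: blinfun.zero_right)
  qed simp
  moreover have image_bound: "norm (T h) \<le> M" if "norm h \<le> 1" for h
    using norm_blinfun[of T h] mult_left_mono[OF that, of "norm T"] by (simp add: M_def)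
  then have "K \<subseteq> cball 0 M"
    unfolding K_def by (intro closure_minimal) auto
  ultimately have norm_k: "norm k = M"
    using k(1) by auto
  obtain h where h: "\<And>n :: nat. norm (h n) \<le> 1" and lim: "(\<lambda>n. T (h n)) \<longlonglongrightarrow> k"
  proof -
    obtain x where x: "\<And>n :: nat. x n \<in> blinfun_apply T ` cball 0 1" and "x \<longlonglongrightarrow> k"
      using k(1) unfolding K_def closure_sequential by blast
    have "\<forall>n. \<exists>u. norm u \<le> 1 \<and> x n = T u"
      using x by fastforce
    then obtain h where "\<And>n. norm (h n) \<le> 1" "x = (\<lambda>n. T (h n))"
      by metis
    with \<open>x \<longlonglongrightarrow> k\<close> show ?thesis
      using that by blast
  qed
  have defect: "(norm (T (h n) - M *\<^sub>R h n))\<^sup>2 \<le> M\<^sup>2 - (norm (T (h n)))\<^sup>2" for n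
  proof -
    have "Re (cinner (T (h n)) (M *\<^sub>R h n)) = M * Re (cinner (h n) (T (h n)))"
      by (simp add: bicinner.scaleR_right positive_op_selfadjoint[OF T])
    then have "(norm (T (h n) - M *\<^sub>R h n))\<^sup>2 =
        (norm (T (h n)))\<^sup>2 - 2 * (M * Re (cinner (h n) (T (h n)))) + M\<^sup>2 * (norm (h n))\<^sup>2"
      using \<open>M > 0\<close> by (simp add: norm_diff_cinner power_mult_distrib)
    moreover have "M\<^sup>2 * (norm (h n))\<^sup>2 \<le> M\<^sup>2 * 1"
      using h[of n] by (intro mult_left_mono) (simp_all add: power_le_one)
    ultimately show ?thesis
      using positive_op_norm_bound[OF T, of "h n"] by (simp add: M_def)
  qed
  have "(\<lambda>n. M\<^sup>2 - (norm (T (h n)))\<^sup>2) \<longlonglongrightarrow> M\<^sup>2 - (norm k)\<^sup>2"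
    by (intro tendsto_intros lim)
  then have defect_lim: "(\<lambda>n. M\<^sup>2 - (norm (T (h n)))\<^sup>2) \<longlonglongrightarrow> 0"
    by (simp add: norm_k)
  have "(\<lambda>n. (norm (T (h n) - M *\<^sub>R h n))\<^sup>2) \<longlonglongrightarrow> 0"
    by (rule tendsto_sandwich[OF _ _ tendsto_const defect_lim]) (simp_all add: defect)
  then have "(\<lambda>n. T (h n) - M *\<^sub>R h n) \<longlonglongrightarrow> 0"
    by (simp add: tendsto_norm_zero_iff)
  then have "(\<lambda>n. T (h n) - (T (h n) - M *\<^sub>R h n)) \<longlonglongrightarrow> k - 0"
    by (intro tendsto_diff lim)
  then have "(\<lambda>n. T (M *\<^sub>R h n)) \<longlonglongrightarrow> T k"
    by (intro blinfun.tendsto tendsto_const) simp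
  moreover have "(\<lambda>n. T (M *\<^sub>R h n)) \<longlonglongrightarrow> M *\<^sub>R k"
    unfolding blinfun.scaleR_right by (intro tendsto_intros lim)
  ultimately have "T k = M *\<^sub>R k"
    by (rule LIMSEQ_unique)
  then show ?thesis
    using \<open>M > 0\<close> norm_k
    by (intro exI[of _ "(1 / M) *\<^sub>R k"])
      (simp add: blinfun.scaleR_right bicinner.scaleR_right bicinner.scaleR_left cinner_self
        power2_eq_square flip: M_def)
qed

section \<open>Rank-one projections\<close>

text \<open>For a unit vector \<open>h\<close>, the orthogonal projection onto its span.\<close>

definition rank_one :: "'h::complex_hilbert_space \<Rightarrow> 'h \<Rightarrow>\<^sub>L 'h"
  where "rank_one h = Blinfun (\<lambda>g. cinner h g *\<^sub>C h)"

lemma bounded_linear_scaleC_left: "bounded_linear (\<lambda>c. c *\<^sub>C h)"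
  for h :: "'h::complex_normed_vector"
  by (rule bounded_linear_intro[where K = "norm h"])
    (simp_all add: scaleC_add_left scaleR_scaleC scaleC_scaleC norm_scaleC scaleR_conv_of_real
      scaleC_complex_def)

lemma rank_one_apply [simp]: "rank_one h g = cinner h g *\<^sub>C h"
  unfolding rank_one_def
  by (subst bounded_linear_Blinfun_apply)
    (auto intro: bounded_linear_compose[OF bounded_linear_scaleC_left bicinner.bounded_linear_right])

lemma complex_linear_op_rank_one: "complex_linear_op (rank_one h)"
  by (simp add: complex_linear_op_def cinner.scaleC_right scaleC_scaleC)

lemma positive_op_rank_one: "positive_op (rank_one h)"
  unfolding positive_op_def
proof (intro conjI allI complex_linear_op_rank_one)
  fix g
  have "cinner g (rank_one h g) = complex_of_real ((cmod (cinner h g))\<^sup>2)"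
    using complex_norm_square[of "cinner h g"] cinner_commute[of g h]
    by (simp add: cinner.scaleC_right)
  then show "cinner g (rank_one h g) \<in> \<real>\<^sub>\<ge>\<^sub>0"
    by (simp only: nonneg_Reals_of_real_iff) simp
qed

lemma rank_one_compact: "rank_one h \<in> compact_ops"
proof -
  let ?K = "(\<lambda>c. c *\<^sub>C h) ` cball 0 (norm h)"
  have "compact ?K"
    by (intro compact_continuous_image linear_continuous_on bounded_linear_scaleC_left) simp
  moreover have "closure (blinfun_apply (rank_one h) ` cball 0 1) \<subseteq> ?K"
  proof (rule closure_minimal)
    have "cmod (cinner h g) \<le> norm h" if "norm g \<le> 1" for g
      using cinner.cmod_le_norm[of h g] mult_left_mono[OF that, of "norm h"] by simp
    then show "blinfun_apply (rank_one h) ` cball 0 1 \<subseteq> ?K"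
      by auto
  qed (rule compact_imp_closed[OF \<open>compact ?K\<close>])
  ultimately have "compact (closure (blinfun_apply (rank_one h) ` cball 0 1))"
    by (metis inf.absorb_iff2 compact_Int_closed closed_closure)
  then show ?thesis
    by (simp add: compact_ops_def complex_linear_op_rank_one)
qed

text \<open>Uniqueness of the positive square root \<open>S\<close>: it commutes with its square, so it maps \<open>h\<close> to a
multiple \<open>c h\<close>, and \<open>c\<^sup>2 = 1\<close> with \<open>c \<ge> 0\<close>; on the complement of \<open>h\<close> it vanishes because its square
does.\<close>

lemma sqrt_op_rank_one:
  fixes h :: "'h::complex_hilbert_space"
  assumes h: "norm h = 1"
  shows "sqrt_op (rank_one h) = rank_one h"
  unfolding sqrt_op_def
proof (rule the_equality)
  have hh: "cinner h h = 1"
    by (simp add: cinner_self h)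
  show "positive_op (rank_one h) \<and> rank_one h o\<^sub>L rank_one h = rank_one h"
    by (intro conjI positive_op_rank_one blinfun_eqI)
      (simp add: cinner.scaleC_right hh)
  fix S :: "'h \<Rightarrow>\<^sub>L 'h" assume S: "positive_op S \<and> S o\<^sub>L S = rank_one h"
  have SS: "S (S g) = cinner h g *\<^sub>C h" for g
    using arg_cong[OF conjunct2[OF S], of "\<lambda>T. blinfun_apply T g"] by simp
  have S_lin: "S (c *\<^sub>C g) = c *\<^sub>C S g" for c g
    using S by (simp add: positive_op_def complex_linear_opD)
  define c where "c = cinner h (S h)"
  have Sh: "S h = c *\<^sub>C h"
    using SS[of "S h"] SS[of h] by (simp add: c_def hh scaleC_one)
  have "c *\<^sub>C c *\<^sub>C h = h"
    using SS[of h] by (simp add: Sh S_lin hh scaleC_one)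
  then have "c * c = 1"
    using arg_cong[of _ _ "cinner h"] by (metis cinner.scaleC_right hh mult.right_neutral)
  moreover have "c \<in> \<real>\<^sub>\<ge>\<^sub>0"
    using S by (simp add: positive_op_def c_def)
  ultimately have "c = 1"
    by (metis complex_nonneg_Reals_iff neg_0_le_iff_le not_one_le_zero one_complex.sel(1)
        square_eq_1_iff uminus_complex.sel(1))
  then have Sh: "S h = h"
    by (simp add: Sh scaleC_one)
  show "S = rank_one h"
  proof (rule blinfun_eqI)
    fix g
    define k where "k = g - cinner h g *\<^sub>C h"
    have "cinner h k = 0"
      by (simp add: k_def bicinner.diff_right cinner.scaleC_right hh)
    then have "cinner (S k) (S k) = 0"
      using S by (simp add: positive_op_selfadjoint SS cinner.scaleC_right)
    then have "S k = 0"
      by (simp add: cinner_self)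
    then show "S g = rank_one h g"
      by (simp add: k_def blinfun.diff_right S_lin Sh)
  qed
qed

lemma abs_op_rank_one:
  assumes h: "norm h = 1"
  shows "abs_op (rank_one h) = rank_one h"
proof -
  have "adj (rank_one h) = rank_one h"
    by (intro adj_eqI positive_op_selfadjoint positive_op_rank_one)
  moreover have "rank_one h o\<^sub>L rank_one h = rank_one h"
    by (rule blinfun_eqI) (simp add: cinner.scaleC_right cinner_self h)
  ultimately show ?thesis
    by (simp add: abs_op_def sqrt_op_rank_one[OF h])
qed

lemma rank_one_trace_class:
  assumes h: "norm h = 1"
  shows "rank_one h \<in> trace_class"
  using has_sum_imp_summable[OF Parseval[of h h]]
  by (simp add: trace_class_def rank_one_compact abs_op_rank_one[OF h] cinner.scaleC_right)

text \<open>The diagonal sum is the Parseval expansion of \<open>cinner (adj T h) h\<close>.\<close>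

lemma tr_rank_one_compose:
  assumes T: "complex_linear_op T"
  shows "tr (rank_one h o\<^sub>L T) = cinner h (T h)"
proof -
  have "tr (rank_one h o\<^sub>L T) = (\<Sum>\<^sub>\<infinity>e\<in>some_basis. cinner (adj T h) e * cinner e h)"
    by (simp add: tr_def cinner.scaleC_right cinner_adj[OF T])
  also have "\<dots> = cinner (adj T h) h"
    by (rule infsumI[OF Parseval])
  finally show ?thesis
    by (simp add: cinner_adj[OF T])
qed

lemma tr_rank_one: "tr (rank_one h) = cinner h h"
  unfolding tr_def by (simp add: cinner.scaleC_right infsumI[OF Parseval])

section \<open>Forms on the module given by families of vectors\<close>

lemma scaleC_blinfun_apply: "(c *\<^sub>C T) h = c *\<^sub>C T h"
  for T :: "'a::real_normed_vector \<Rightarrow>\<^sub>L 'b::complex_normed_vector"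
  by transfer simp

context hilbert_compact_module
begin

lemma complex_linear_op_ip: "complex_linear_op (ip x y)"
  using ip_compact by (simp add: compact_ops_def)

lemma cinner_ip: "cinner (ip x y g) h = cinner g (ip y x h)"
  using cinner_adj[OF complex_linear_op_ip[of y x]] by (simp add: ip_adj)

text \<open>Additivity and conjugate linearity in the first argument are inherited through the adjoint.\<close>

lemma cinner_ip_add_left: "cinner g (ip (x + y) z h) = cinner g (ip x z h) + cinner g (ip y z h)"
  unfolding cinner_ip[symmetric] by (simp add: ip_add_right blinfun.add_left cinner.add_left)

lemma cinner_ip_scaleC_left: "cinner g (ip (c *\<^sub>C x) y h) = cnj c * cinner g (ip x y h)"
  unfolding cinner_ip[symmetric]
  by (simp add: ip_scaleC_right scaleC_blinfun_apply cinner.scaleC_left)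

lemma cmod_cinner_ip_le: "cmod (cinner h (ip x y h)) \<le> norm (ip x y) * (norm h)\<^sup>2"
proof -
  have "cmod (cinner h (ip x y h)) \<le> norm h * norm (ip x y h)"
    by (rule cinner.cmod_le_norm)
  also have "\<dots> \<le> norm h * (norm (ip x y) * norm h)"
    by (intro mult_left_mono norm_blinfun) simp
  finally show ?thesis
    by (simp add: power2_eq_square mult_ac)
qed

lemma norm_ip_self: "norm (ip x x) = (norm x)\<^sup>2"
  by (simp add: norm_eq)

text \<open>This covers the vector state of a single unit vector and the state that a density operator
induces. Convergence and the diagonal bound both come from \<open>cmod_cinner_ip_le\<close>.\<close>

lemma contractive_form_vector_family:
  assumes v: "((\<lambda>e. (norm (v e))\<^sup>2) has_sum 1) B"
  shows "contractive_form (\<lambda>x y. \<Sum>\<^sub>\<infinity>e\<in>B. cinner (v e) (ip x y (v e)))"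
proof -
  have summable: "(\<lambda>e. cinner (v e) (ip x y (v e))) summable_on B" for x y
  proof (rule abs_summable_summable, rule Infinite_Sum.abs_summable_on_comparison_test')
    show "(\<lambda>e. norm (ip x y) * (norm (v e))\<^sup>2) summable_on B"
      by (rule summable_on_cmult_right[OF has_sum_imp_summable[OF v]])
  qed (rule cmod_cinner_ip_le)
  show ?thesis
  proof
    fix x y z :: 'x and c
    show "(\<Sum>\<^sub>\<infinity>e\<in>B. cinner (v e) (ip (x + y) z (v e))) =
        (\<Sum>\<^sub>\<infinity>e\<in>B. cinner (v e) (ip x z (v e))) + (\<Sum>\<^sub>\<infinity>e\<in>B. cinner (v e) (ip y z (v e)))"
      unfolding cinner_ip_add_left by (rule infsum_add[OF summable summable])
    show "(\<Sum>\<^sub>\<infinity>e\<in>B. cinner (v e) (ip x (y + z) (v e))) =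
        (\<Sum>\<^sub>\<infinity>e\<in>B. cinner (v e) (ip x y (v e))) + (\<Sum>\<^sub>\<infinity>e\<in>B. cinner (v e) (ip x z (v e)))"
      unfolding ip_add_right blinfun.add_left cinner.add_right
      by (rule infsum_add[OF summable summable])
    show "(\<Sum>\<^sub>\<infinity>e\<in>B. cinner (v e) (ip (c *\<^sub>C x) y (v e))) =
        cnj c * (\<Sum>\<^sub>\<infinity>e\<in>B. cinner (v e) (ip x y (v e)))"
      unfolding cinner_ip_scaleC_left by (rule infsum_cmult_right[OF summable])
    show "(\<Sum>\<^sub>\<infinity>e\<in>B. cinner (v e) (ip x (c *\<^sub>C y) (v e))) =
        c * (\<Sum>\<^sub>\<infinity>e\<in>B. cinner (v e) (ip x y (v e)))"
      unfolding ip_scaleC_right scaleC_blinfun_apply cinner.scaleC_right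
      by (rule infsum_cmult_right[OF summable])
    have nonneg: "cinner h (ip x x h) \<in> \<real>\<^sub>\<ge>\<^sub>0" for h
      using ip_self_positive by (simp add: positive_op_def)
    have "((\<lambda>e. Re (cinner (v e) (ip x x (v e)))) has_sum
        Re (\<Sum>\<^sub>\<infinity>e\<in>B. cinner (v e) (ip x x (v e)))) B"
      by (intro has_sum_Re has_sum_infsum summable)
    moreover have "((\<lambda>e. (norm x)\<^sup>2 * (norm (v e))\<^sup>2) has_sum (norm x)\<^sup>2 * 1) B"
      by (rule has_sum_cmult_right[OF v])
    moreover have "Re (cinner (v e) (ip x x (v e))) \<le> (norm x)\<^sup>2 * (norm (v e))\<^sup>2" for e
      using cmod_cinner_ip_le[of "v e" x x] complex_Re_le_cmod[of "cinner (v e) (ip x x (v e))"]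
      by (simp add: norm_ip_self)
    ultimately show "Re (\<Sum>\<^sub>\<infinity>e\<in>B. cinner (v e) (ip x x (v e))) \<le> (norm x)\<^sup>2"
      using has_sum_mono by fastforce
    have "(\<Sum>\<^sub>\<infinity>e\<in>B. cinner (v e) (ip x x (v e))) \<ge> 0"
      using nonneg by (intro infsum_nonneg_complex summable)
        (simp add: complex_nonneg_Reals_iff less_eq_complex_def)
    then show "(\<Sum>\<^sub>\<infinity>e\<in>B. cinner (v e) (ip x x (v e))) \<in> \<real>\<^sub>\<ge>\<^sub>0"
      by (simp add: complex_nonneg_Reals_iff less_eq_complex_def)
  qed
qed

end

theorem proposition2p2:
  fixes act :: "'x::complex_banach \<Rightarrow> ('h::complex_hilbert_space \<Rightarrow>\<^sub>L 'h) \<Rightarrow> 'x"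
    and ip :: "'x \<Rightarrow> 'x \<Rightarrow> ('h \<Rightarrow>\<^sub>L 'h)"
    and x y :: 'x
  assumes "hilbert_compact_module act ip"
    and "\<exists>h::'h. h \<noteq> 0"
  shows "x \<parallel> y \<longleftrightarrow>
    (\<exists>P \<in> trace_class. positive_op P \<and> tr P = 1 \<and>
      cmod (tr (P o\<^sub>L ip x y)) = norm x * norm y)"
proof -
  interpret hilbert_compact_module act ip
    by (rule assms(1))
  show ?thesis
  proof
    assume "x \<parallel> y"
    then obtain c where c: "cmod c = 1" "norm (x + c *\<^sub>C y) = norm x + norm y"
      unfolding norm_parallel_def by blast
    let ?z = "x + c *\<^sub>C y"
    obtain h where h: "norm h = 1" "Re (cinner h (ip ?z ?z h)) = norm (ip ?z ?z)"
      using compact_positive_op_norming_vector[OF ip_compact ip_self_positive assms(2)] by blast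
    have "((\<lambda>e. (norm e)\<^sup>2) has_sum 1) {h}"
      using h(1) by (intro has_sum_finiteI) simp_all
    then interpret s: contractive_form "\<lambda>x y. cinner h (ip x y h)"
      using contractive_form_vector_family[of "\<lambda>e. e" "{h}"] by simp
    have "cmod (cinner h (ip x y h)) = norm x * norm y"
      using s.norming_if_norm_add[OF c] h(2) by (simp add: norm_ip_self)
    then show "\<exists>P \<in> trace_class. positive_op P \<and> tr P = 1 \<and>
        cmod (tr (P o\<^sub>L ip x y)) = norm x * norm y"
      using h(1)
      by (intro bexI[of _ "rank_one h"] conjI rank_one_trace_class positive_op_rank_one)
        (simp_all add: tr_rank_one tr_rank_one_compose complex_linear_op_ip cinner_self)
  next
    assume "\<exists>P \<in> trace_class. positive_op P \<and> tr P = 1 \<and>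
      cmod (tr (P o\<^sub>L ip x y)) = norm x * norm y"
    then obtain P :: "'h \<Rightarrow>\<^sub>L 'h" where P: "positive_op P" "tr P = 1"
      and norming: "cmod (tr (P o\<^sub>L ip x y)) = norm x * norm y"
      by blast
    obtain A :: "'h \<Rightarrow>\<^sub>L 'h" where A: "((\<lambda>e. (norm (A e))\<^sup>2) has_sum 1) some_basis"
      and tr: "\<And>T. complex_linear_op T \<Longrightarrow>
        tr (P o\<^sub>L T) = (\<Sum>\<^sub>\<infinity>e\<in>some_basis. cinner (A e) (T (A e)))"
      using trace_compose_positive[OF P(1)] P(2) by auto
    interpret s: contractive_form "\<lambda>x y. \<Sum>\<^sub>\<infinity>e\<in>some_basis. cinner (A e) (ip x y (A e))"
      by (rule contractive_form_vector_family[OF A])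
    show "x \<parallel> y"
      using norming tr[OF complex_linear_op_ip] by (intro s.norm_parallel_if_norming) simp
  qed
qed

end
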